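(* Let $(M,g)$ be a 3-dimensional Lorentzian manifold foliated by level sets of a time function $t$, with adapted coordinates $(t,x^1,x^2)$ in which the metric has vanishing shift: $g=-N^2\,\mathrm dt\otimes\mathrm dt+\gamma_{ij}\,\mathrm dx^i\otimes\mathrm dx^j$, with lapse $N>0$ and $\gamma$ the induced Riemannian metric on the spatial slices. Let $\epsilon_0>0$ be a constant, $F$ a 2-form (electromagnetic field tensor) and $\underline j$ a 1-form (electric 3-current) on $M$. Then the Maxwell equations $$\mathrm dF=0,\qquad \mathrm d\star F=\epsilon_0^{-1}\star\underline j$$ can be rewritten in the 2+1 formulation $$\begin{aligned}\widetilde{\mathrm d}(N\widetilde E)&=-\partial_t(B\,\widetilde{\mathrm{vol}}),\\-\widetilde\delta\widetilde E&=\frac{\rho}{\epsilon_0},\\\widetilde\delta(NB\,\widetilde{\mathrm{vol}})&=\epsilon_0^{-1}\widetilde J+\widetilde\star^{-1}\partial_t(\widetilde\star\widetilde E),\end{aligned}$$ where $E:=-\mathsf i_nF$, $B:=\mathsf i_n(\star F)$, $\rho:=-\underline j(n)$, $J:=N(\underline j-n^\flat\rho)$.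
   Context: $n:=(-N\mathrm dt)^\sharp$ is the future pointing unit normal to the slices (here $n=\frac1N\partial_t$). $\sharp,\flat$ raise/lower indices with $g$. Greek indices run over $0,1,2$, Latin ones over $1,2$; $x^0=t$. $\mathsf i_X$ is the interior product, $\mathsf i_X\mu(v_1,\dots)=\mu(X,v_1,\dots)$. The volume form of $g$ is $\mathrm{vol}=\sqrt{-\det g}\,\mathrm dt\wedge\mathrm dx^1\wedge\mathrm dx^2$, and the Hodge star on $M$ (dimension $3$) is $$\star(\mathrm dx^{\mu_1}\wedge\dots\wedge\mathrm dx^{\mu_k})=\frac{\sqrt{-\det g}}{(3-k)!}\,g^{\mu_1\nu_1}\cdots g^{\mu_k\nu_k}\,\epsilon_{\nu_1\dots\nu_3}\,\mathrm dx^{\nu_{k+1}}\wedge\dots\wedge\mathrm dx^{\nu_3},$$ with $\epsilon$ the Levi-Civita symbol. Objects with a tilde are spatial objects on the slices: $\widetilde{\mathrm d}$, $\widetilde{\mathrm{vol}}=\sqrt{\det\gamma}\,\mathrm dx^1\wedge\mathrm dx^2$, $\widetilde\star$ are the spatial exterior derivative and the volume form and Hodge star of $\gamma$ (same formula with $\sqrt{\det\gamma}$ and dimension $2$); $\widetilde\delta:=(-1)^k\widetilde\star^{-1}\widetilde{\mathrm d}\,\widetilde\star$ on spatial $k$-forms; for a 1-form $V=V_0\mathrm dt+V_i\mathrm dx^i$, $\widetilde V=V_i\mathrm dx^i$ is its restriction to the slices. $\partial_t$ acting on spatial forms is the Lie derivative along $\partial_t$ (derivative of the components in adapted coordinates).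 All fields are assumed smooth. *)

theory Defs
  imports "HOL-Analysis.Analysis"
begin

section \<open>Partial derivatives and smoothness in coordinates\<close>

text \<open>
  Spacetime coordinates \<open>(t, x\<^sup>1, x\<^sup>2)\<close> are the points of \<^typ>\<open>real^3\<close>.  Greek indices are the
  elements \<open>0, 1, 2\<close> of the type \<^typ>\<open>3\<close>; Latin indices are the elements \<open>1, 2\<close> of the type
  \<^typ>\<open>2\<close>, in which \<open>2 = 0\<close>.  The map \<open>lat\<close> reads a Latin index as a Greek one.
\<close>

definition lat :: "2 \<Rightarrow> 3" where
  "lat i = (if i = 1 then 1 else 2)"

definition pd :: "3 \<Rightarrow> (real^3 \<Rightarrow> real) \<Rightarrow> real^3 \<Rightarrow> real" where
  "pd \<mu> f x = deriv (\<lambda>h. f (x + h *\<^sub>R axis \<mu> 1)) 0"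

text \<open>\<open>C\<^sup>\<infinity>\<close> on an open set: every iterated partial derivative, including \<open>f\<close> itself, is
  (totally) differentiable at each point.\<close>

definition smooth_on :: "(real^3) set \<Rightarrow> (real^3 \<Rightarrow> real) \<Rightarrow> bool" where
  "smooth_on U f \<longleftrightarrow> (\<forall>is. \<forall>x\<in>U. foldr pd is f differentiable (at x))"


section \<open>Tensors and forms at a point\<close>

text \<open>
  A covariant tensor at a point is given by its components, indexed by lists of indices.  For a
  \<open>k\<close>-form these are \<open>\<omega> [\<mu>\<^sub>1, \<dots>, \<mu>\<^sub>k] = \<omega> (\<partial>\<^sub>\<mu>\<^sub>1, \<dots>, \<partial>\<^sub>\<mu>\<^sub>k)\<close>, so that
  \<open>\<omega> = 1/k! \<Sum> \<omega> [\<mu>\<^sub>1, \<dots>, \<mu>\<^sub>k] dx\<^sup>\<mu>\<^sup>1 \<and> \<dots> \<and> dx\<^sup>\<mu>\<^sup>k\<close>.  The operators on forms are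
  uniform in the index type \<open>'n\<close>; their argument \<open>e\<close> tells which spacetime coordinate an index
  stands for: \<open>e = id\<close> for spacetime objects (\<open>'n = 3\<close>), \<open>e = lat\<close> for spatial ones (\<open>'n = 2\<close>).
\<close>

type_synonym 'n covec = "'n list \<Rightarrow> real"

definition kforms :: "nat \<Rightarrow> ('n covec) set" where
  "kforms k = {\<omega>. (\<forall>is. length is \<noteq> k \<longrightarrow> \<omega> is = 0) \<and>
                  (\<forall>is a b. a < b \<and> b < length is \<longrightarrow> \<omega> (is[a := is ! b, b := is ! a]) = - \<omega> is)}"

definition scalar_form :: "real \<Rightarrow> 'n covec" where
  "scalar_form r is = (if is = [] then r else 0)"

definition dx :: "'n \<Rightarrow> 'n covec" where
  "dx \<mu> is = (if is = [\<mu>] then 1 else 0)"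

definition flat :: "real^'n^'n \<Rightarrow> real^'n \<Rightarrow> 'n covec" where
  "flat G v is = (case is of [\<mu>] \<Rightarrow> (G *v v) $ \<mu> | _ \<Rightarrow> 0)"

definition sharp :: "real^'n^'n \<Rightarrow> 'n covec \<Rightarrow> real^'n" where
  "sharp G \<alpha> = matrix_inv G *v (\<chi> \<mu>. \<alpha> [\<mu>])"

definition interior_product :: "real^'n \<Rightarrow> 'n covec \<Rightarrow> 'n covec" where
  "interior_product v \<omega> is = (\<Sum>\<mu>\<in>UNIV. v $ \<mu> * \<omega> (\<mu> # is))"

text \<open>Indices are ordered through \<open>e\<close>, as the order of the type \<^typ>\<open>2\<close> would put \<open>2 = 0\<close> before
  \<open>1\<close>: \<open>\<epsilon>\<^sub>0\<^sub>1\<^sub>2 = 1\<close> in spacetime and \<open>\<epsilon>\<^sub>1\<^sub>2 = 1\<close> in space.\<close>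

definition levi_civita :: "('n \<Rightarrow> 3) \<Rightarrow> 'n covec" where
  "levi_civita e is =
     (if distinct is \<and> set is = UNIV
      then (-1) ^ card {(a, b). a < b \<and> b < length is \<and> e (is ! a) > e (is ! b)} else 0)"

definition volume_form :: "('n::finite \<Rightarrow> 3) \<Rightarrow> real^'n^'n \<Rightarrow> 'n covec" where
  "volume_form e G is = sqrt \<bar>det G\<bar> * levi_civita e is"

text \<open>
  Hodge star of the metric \<open>G\<close>: the components of the linear extension of
  \<open>\<star>(dx\<^sup>\<mu>\<^sup>1 \<and> \<dots> \<and> dx\<^sup>\<mu>\<^sup>k) = \<surd>\<bar>det G\<bar> / (n-k)! G\<^sup>\<mu>\<^sup>1\<^sup>\<nu>\<^sup>1 \<cdots> G\<^sup>\<mu>\<^sup>k\<^sup>\<nu>\<^sup>k \<epsilon>\<^sub>\<nu>\<^sub>1\<^sub>\<dots>\<^sub>\<nu>\<^sub>n dx\<^sup>\<nu>\<^sup>k\<^sup>+\<^sup>1 \<and> \<dots> \<and> dx\<^sup>\<nu>\<^sup>n\<close>.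
  The factor \<open>1/k!\<close> comes from expanding the argument, and \<open>1/(n-k)!\<close> is absorbed in passing to
  components.  Note \<open>\<bar>det G\<bar> = - det G\<close> for Lorentzian and \<open>\<bar>det G\<bar> = det G\<close> for Riemannian \<open>G\<close>.
\<close>

definition hodge :: "('n::finite \<Rightarrow> 3) \<Rightarrow> real^'n^'n \<Rightarrow> 'n covec \<Rightarrow> 'n covec" where
  "hodge e G \<omega> js =
     (let k = CARD('n) - length js in
      sqrt \<bar>det G\<bar> / fact k *
      (\<Sum>ms | length ms = k. \<Sum>ns | length ns = k.
         \<omega> ms * (\<Prod>a<k. matrix_inv G $ (ms ! a) $ (ns ! a)) * levi_civita e (ns @ js)))"

definition hodge_inv :: "('n::finite \<Rightarrow> 3) \<Rightarrow> nat \<Rightarrow> real^'n^'n \<Rightarrow> 'n covec \<Rightarrow> 'n covec" where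
  "hodge_inv e k G = inv_into (kforms k) (hodge e G)"


section \<open>Fields in a coordinate domain\<close>

type_synonym 'n field = "real^3 \<Rightarrow> 'n covec"

definition ext_d :: "('n \<Rightarrow> 3) \<Rightarrow> 'n field \<Rightarrow> 'n field" where
  "ext_d e \<omega> x is =
     (\<Sum>a<length is. (-1) ^ a * pd (e (is ! a)) (\<lambda>y. \<omega> y (take a is @ drop (Suc a) is)) x)"

definition star :: "('n::finite \<Rightarrow> 3) \<Rightarrow> (real^3 \<Rightarrow> real^'n^'n) \<Rightarrow> 'n field \<Rightarrow> 'n field" where
  "star e G \<omega> x = hodge e (G x) (\<omega> x)"

definition star_inv :: "('n::finite \<Rightarrow> 3) \<Rightarrow> nat \<Rightarrow> (real^3 \<Rightarrow> real^'n^'n) \<Rightarrow> 'n field \<Rightarrow> 'n field" where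
  "star_inv e k G \<omega> x = hodge_inv e k (G x) (\<omega> x)"

text \<open>\<open>\<delta> = (-1)\<^sup>k \<star>\<^sup>-\<^sup>1 d \<star>\<close> on \<open>k\<close>-forms, \<open>k \<ge> 1\<close>; the result is a \<open>(k-1)\<close>-form.\<close>

definition codiff :: "('n::finite \<Rightarrow> 3) \<Rightarrow> nat \<Rightarrow> (real^3 \<Rightarrow> real^'n^'n) \<Rightarrow> 'n field \<Rightarrow> 'n field" where
  "codiff e k G \<omega> x is = (-1) ^ k * star_inv e (k - 1) G (ext_d e (star e G \<omega>)) x is"

definition fn_mult :: "(real^3 \<Rightarrow> real) \<Rightarrow> 'n field \<Rightarrow> 'n field" where
  "fn_mult f \<omega> x is = f x * \<omega> x is"

definition time_deriv :: "2 field \<Rightarrow> 2 field" where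
  "time_deriv \<omega> x is = pd 0 (\<lambda>y. \<omega> y is) x"

definition spatial :: "3 field \<Rightarrow> 2 field" where
  "spatial \<omega> x is = \<omega> x (map lat is)"

definition metric_matrix :: "3 field \<Rightarrow> real^3 \<Rightarrow> real^3^3" where
  "metric_matrix g x = (\<chi> \<mu> \<nu>. g x [\<mu>, \<nu>])"

definition induced_metric :: "3 field \<Rightarrow> real^3 \<Rightarrow> real^2^2" where
  "induced_metric g x = (\<chi> i j. g x [lat i, lat j])"

abbreviation spatial_volume :: "3 field \<Rightarrow> 2 field" where
  "spatial_volume g \<equiv> (\<lambda>x. volume_form lat (induced_metric g x))"


section \<open>Spacetimes foliated by a time function, with adapted coordinates\<close>

text \<open>A chart is a pair of its domain and its coordinate map.\<close>

type_synonym 'a chart = "'a set \<times> ('a \<Rightarrow> real^3)"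

definition coords :: "'a chart \<Rightarrow> (real^3) set" where
  "coords c = snd c ` fst c"

definition in_chart :: "'a chart \<Rightarrow> ('a \<Rightarrow> 'b) \<Rightarrow> real^3 \<Rightarrow> 'b" where
  "in_chart c f x = f (inv_into (fst c) (snd c) x)"

definition smooth_manifold3 :: "'a topology \<Rightarrow> 'a chart set \<Rightarrow> bool" where
  "smooth_manifold3 X A \<longleftrightarrow>
     Hausdorff_space X \<and> second_countable X \<and>
     (\<Union>c\<in>A. fst c) = topspace X \<and>
     (\<forall>c\<in>A. openin X (fst c) \<and> open (coords c) \<and>
             homeomorphic_map (subtopology X (fst c)) (top_of_set (coords c)) (snd c)) \<and>
     (\<forall>c\<in>A. \<forall>c'\<in>A. \<forall>\<mu>. smooth_on (snd c' ` (fst c \<inter> fst c')) (\<lambda>y. in_chart c' (snd c) y $ \<mu>))"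

text \<open>Smooth covariant tensor fields of rank \<open>k\<close>: a family of components, one for each chart,
  related by the tensor transformation law on overlaps.\<close>

type_synonym 'a tensor = "'a chart \<Rightarrow> 3 field"

definition tensor_field :: "'a chart set \<Rightarrow> nat \<Rightarrow> 'a tensor \<Rightarrow> bool" where
  "tensor_field A k T \<longleftrightarrow>
     (\<forall>c\<in>A. \<forall>is. smooth_on (coords c) (\<lambda>x. T c x is)) \<and>
     (\<forall>c\<in>A. \<forall>x\<in>coords c. \<forall>is. length is \<noteq> k \<longrightarrow> T c x is = 0) \<and>
     (\<forall>c\<in>A. \<forall>c'\<in>A. \<forall>p\<in>fst c \<inter> fst c'. \<forall>js. length js = k \<longrightarrow>
        T c' (snd c' p) js =
        (\<Sum>is | length is = k.
           (\<Prod>a<k. pd (js ! a) (\<lambda>y. in_chart c' (snd c) y $ (is ! a)) (snd c' p)) * T c (snd c p) is))"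

definition form_field :: "'a chart set \<Rightarrow> nat \<Rightarrow> 'a tensor \<Rightarrow> bool" where
  "form_field A k \<omega> \<longleftrightarrow> tensor_field A k \<omega> \<and> (\<forall>c\<in>A. \<forall>x\<in>coords c. \<omega> c x \<in> kforms k)"

text \<open>
  \<open>A\<close> is an atlas of \<open>M\<close> by charts \<open>(t, x\<^sup>1, x\<^sup>2)\<close> adapted to the time function \<open>t\<close>, in which
  \<open>g = - N\<^sup>2 dt \<otimes> dt + \<gamma>\<^sub>i\<^sub>j dx\<^sup>i \<otimes> dx\<^sup>j\<close> with \<open>N > 0\<close> and \<open>\<gamma>\<close> symmetric and positive definite; in
  particular \<open>g\<close> is symmetric of signature \<open>(-,+,+)\<close>.
\<close>

definition foliated_spacetime ::
    "'a topology \<Rightarrow> 'a chart set \<Rightarrow> ('a \<Rightarrow> real) \<Rightarrow> ('a \<Rightarrow> real) \<Rightarrow> 'a tensor \<Rightarrow> bool" where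
  "foliated_spacetime X A t N g \<longleftrightarrow>
     smooth_manifold3 X A \<and>
     (\<forall>c\<in>A. \<forall>p\<in>fst c. snd c p $ 0 = t p) \<and>
     (\<forall>p\<in>topspace X. N p > 0) \<and>
     (\<forall>c\<in>A. smooth_on (coords c) (in_chart c N)) \<and>
     tensor_field A 2 g \<and>
     (\<forall>c\<in>A. \<forall>x\<in>coords c.
        g c x [0, 0] = - (in_chart c N x)\<^sup>2 \<and>
        (\<forall>i. g c x [0, lat i] = 0 \<and> g c x [lat i, 0] = 0) \<and>
        transpose (induced_metric (g c) x) = induced_metric (g c) x \<and>
        (\<forall>v. v \<noteq> 0 \<longrightarrow> v \<bullet> (induced_metric (g c) x *v v) > 0))"


section \<open>Electromagnetic fields relative to the slices\<close>

text \<open>Here \<open>g\<close>, \<open>N\<close>, \<open>F\<close> and \<open>j\<close> are coordinate representations in one chart.\<close>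

definition unit_normal :: "3 field \<Rightarrow> (real^3 \<Rightarrow> real) \<Rightarrow> real^3 \<Rightarrow> real^3" where
  "unit_normal g N x = sharp (metric_matrix g x) (\<lambda>is. - N x * dx 0 is)"

definition electric_field :: "3 field \<Rightarrow> (real^3 \<Rightarrow> real) \<Rightarrow> 3 field \<Rightarrow> 3 field" where
  "electric_field g N F x is = - interior_product (unit_normal g N x) (F x) is"

definition magnetic_field :: "3 field \<Rightarrow> (real^3 \<Rightarrow> real) \<Rightarrow> 3 field \<Rightarrow> real^3 \<Rightarrow> real" where
  "magnetic_field g N F x =
     interior_product (unit_normal g N x) (star id (metric_matrix g) F x) []"

definition charge_density :: "3 field \<Rightarrow> (real^3 \<Rightarrow> real) \<Rightarrow> 3 field \<Rightarrow> real^3 \<Rightarrow> real" where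
  "charge_density g N j x = - interior_product (unit_normal g N x) (j x) []"

definition current :: "3 field \<Rightarrow> (real^3 \<Rightarrow> real) \<Rightarrow> 3 field \<Rightarrow> 3 field" where
  "current g N j x is =
     N x * (j x is - flat (metric_matrix g x) (unit_normal g N x) is * charge_density g N j x)"

end

(*
  With vanishing shift, n = (1/N) d/dt, so E has the components -F_0i / N and B vol = F_12 dx^1 dx^2,
  and a computation in components gives star F = N B dt + star~ E.  Hence the only independent component
  of dF is Faraday's law, the 12-component of d star F is Gauss's law, and its 0i-components are
  Ampere's law after applying star~, which is bijective on spatial 1-forms.
*)
theory Submission
  imports Defs
begin

text \<open>The equivalence is proved at each point separately, but the formulas for the fields are
  established on the whole open domain of a chart, because they are substituted under a derivative
  at that point. The powers of N and of \<open>sqrt (det \<gamma>)\<close> in the definitions are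
  chosen so that N E and B vol consist of components of F with no metric factor left, while N B and
  the spatial star of E are themselves components of star F. So the derivatives on the two sides
  match term by term, and no product rule and no derivative of the metric enters. The obstacle is
  the inverse star, which is defined by choice through \<open>inv_into\<close> on forms of a fixed
  degree. Before any components can be compared, each side must be known to be a form of the right
  degree and the star to be a bijection between degrees; this is the purpose of the degree
  lemmas.\<close>

lemma pd_cong:
  assumes "open U" "x \<in> U" "\<And>y. y \<in> U \<Longrightarrow> f y = g y"
  shows "pd \<mu> f x = pd \<mu> g x"
proof -
  let ?l = "\<lambda>h. x + h *\<^sub>R axis \<mu> (1::real)"
  have "open (?l -` U)"
    by (intro open_vimage[OF assms(1)] continuous_intros)
  then have "eventually (\<lambda>h. h \<in> ?l -` U) (nhds 0)"
    using assms(2) by (intro eventually_nhds_in_open) auto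
  then show ?thesis
    unfolding pd_def by (intro deriv_cong_ev) (auto elim: eventually_mono simp: assms(3))
qed

lemma pd_zero [simp]: "pd \<mu> (\<lambda>_. 0) x = 0"
  by (simp add: pd_def)

text \<open>\<open>deriv\<close> is an arbitrary value where no derivative exists, so the sign rule
  asks for differentiability; the chain rule passes it on to the coordinate line. This carries the
  antisymmetry of F through derivatives.\<close>

lemma pd_uminus:
  assumes "f differentiable (at x)"
  shows "pd \<mu> (\<lambda>y. - f y) x = - pd \<mu> f x"
proof -
  let ?l = "\<lambda>h. x + h *\<^sub>R axis \<mu> (1::real)"
  have l: "?l differentiable at 0"
    by (intro derivative_intros)
  have "(f \<circ> ?l) differentiable at 0"
    using assms by (intro differentiable_chain_at l) simp
  then have "(f \<circ> ?l) field_differentiable at 0"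
    by (simp add: field_differentiable_def real_differentiable_def)
  then show ?thesis
    unfolding pd_def o_def by (rule deriv_minus)
qed

section \<open>Sums over index lists and values of the Levi-Civita symbol\<close>

lemma sum_lists_0: "(\<Sum>ms | length ms = 0. f ms) = f []"
  by simp

lemma sum_lists_Suc:
  fixes f :: "'n::finite list \<Rightarrow> real"
  shows "(\<Sum>ms | length ms = Suc k. f ms) = (\<Sum>m\<in>UNIV. \<Sum>ms | length ms = k. f (m # ms))"
proof -
  have "(\<Sum>ms | length ms = Suc k. f ms) = (\<Sum>(m, ms)\<in>UNIV \<times> {ms. length ms = k}. f (m # ms))"
    by (rule sum.reindex_bij_witness[where i = "\<lambda>(m, ms). m # ms" and j = "\<lambda>ms. (hd ms, tl ms)"])
       (auto simp: length_Suc_conv)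
  then show ?thesis
    by (simp add: sum.cartesian_product)
qed

lemma sum_UNIV_3: "sum f (UNIV::3 set) = f 0 + f 1 + (f 2 :: real)"
proof -
  \<comment> \<open>\<open>sum_3\<close> runs over 1, 2, 3, and in this type the numeral 3 is the
    Greek index 0.\<close>
  have "(3::3) = 0" by simp
  then show ?thesis by (simp only: sum_3 add_ac)
qed

lemma levi_civita_not_distinct: "\<not> distinct is \<Longrightarrow> levi_civita e is = 0"
  by (simp add: levi_civita_def)

lemma levi_civita_length:
  "length is \<noteq> CARD('n) \<Longrightarrow> levi_civita e (is :: 'n::finite list) = 0"
  using distinct_card[of "is"] by (auto simp: levi_civita_def)

lemma order_3: "(0::3) < 1" "(0::3) < 2" "(1::3) < 2" "\<not> (1::3) < 0" "\<not> (2::3) < 0" "\<not> (2::3) < 1"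
  by (simp_all add: less_bit1_def bit1.Rep_numeral bit1.Rep_0 bit1.Rep_1)

text \<open>Three entries have only three pairs of positions, and each inverted pair contributes one
  factor -1.\<close>

lemma levi_civita_3:
  assumes "distinct [a, b, c]"
  shows "levi_civita id [a, b, c] =
    (if a > b then -1 else 1) * (if a > c then -1 else 1) * (if b > c then -1 else 1)"
proof -
  have inversions: "{(p, q). p < q \<and> q < length [a, b, c] \<and> id ([a, b, c] ! p) > id ([a, b, c] ! q)}
     = (if a > b then {(0, 1)} else {}) \<union> (if a > c then {(0, 2)} else {})
       \<union> (if b > c then {(1, 2)} else {})"
    by (auto simp: less_Suc_eq numeral_2_eq_2)
  have "set [a, b, c] = UNIV"
    using distinct_card[OF assms] by (intro card_subset_eq) auto
  with assms show ?thesis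
    unfolding levi_civita_def inversions by auto
qed

lemma levi_civita_3_values:
  "levi_civita id [0::3, 1, 2] = 1" "levi_civita id [1::3, 2, 0] = 1" "levi_civita id [2::3, 0, 1] = 1"
  "levi_civita id [0::3, 2, 1] = -1" "levi_civita id [1::3, 0, 2] = -1" "levi_civita id [2::3, 1, 0] = -1"
  by (simp_all add: levi_civita_3 order_3)

text \<open>Entries are compared through \<open>lat\<close>, which places 2 after 1 although 2 = 0
  in the type \<open>2\<close>; hence the sign is positive when the list starts with 1.\<close>

lemma levi_civita_2:
  "levi_civita lat [a, b] = (if a = b then 0 else if a = 1 then 1 else -1)"
proof -
  have inversions: "{(p, q). p < q \<and> q < length [a, b] \<and> lat ([a, b] ! p) > lat ([a, b] ! q)}
     = (if lat a > lat b then {(0, 1)} else {})"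
    by (auto simp: less_Suc_eq)
  have "UNIV = {1, 2::2}" "UNIV = {2, 1::2}" by (auto simp: UNIV_2)
  then show ?thesis
    using exhaust_2[of a] exhaust_2[of b] unfolding levi_civita_def inversions
    by (auto simp: lat_def order_3)
qed

section \<open>Forms of degree at most two\<close>

lemma kforms_0: "kforms 0 = {\<omega>. \<forall>is. length is \<noteq> 0 \<longrightarrow> \<omega> is = 0}"
proof -
  \<comment> \<open>A swap preserves the length, so both sides vanish on lists of the wrong length;
    a list of the right length has no two positions to swap.\<close>
  have "\<omega> (is[a := is ! b, b := is ! a]) = - \<omega> is"
    if "\<forall>is. length is \<noteq> 0 \<longrightarrow> \<omega> is = 0" "a < b" "b < length is" for \<omega> :: "'a covec" and "is" a b
    using that by (cases "length is = 0") auto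
  then show ?thesis unfolding kforms_def by blast
qed

lemma kforms_1: "kforms 1 = {\<omega>. \<forall>is. length is \<noteq> 1 \<longrightarrow> \<omega> is = 0}"
proof -
  have "\<omega> (is[a := is ! b, b := is ! a]) = - \<omega> is"
    if "\<forall>is. length is \<noteq> 1 \<longrightarrow> \<omega> is = 0" "a < b" "b < length is" for \<omega> :: "'a covec" and "is" a b
    using that by (cases "length is = 1") auto
  then show ?thesis by (auto simp: kforms_def)
qed

lemma kforms_2:
  "kforms 2 = {\<omega>. (\<forall>is. length is \<noteq> 2 \<longrightarrow> \<omega> is = 0) \<and> (\<forall>a b. \<omega> [b, a] = - \<omega> [a, b])}"
proof (intro set_eqI iffI)
  fix \<omega> :: "'a covec" assume w: "\<omega> \<in> kforms 2"
  have "\<omega> [b, a] = - \<omega> [a, b]" for a b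
  proof -
    have "\<forall>p q. p < q \<and> q < length [a, b] \<longrightarrow> \<omega> ([a, b][p := [a, b] ! q, q := [a, b] ! p]) = - \<omega> [a, b]"
      using w unfolding kforms_def by blast
    from this[rule_format, of 0 1] show ?thesis by simp
  qed
  then show "\<omega> \<in> {\<omega>. (\<forall>is. length is \<noteq> 2 \<longrightarrow> \<omega> is = 0) \<and> (\<forall>a b. \<omega> [b, a] = - \<omega> [a, b])}"
    using w unfolding kforms_def by blast
next
  fix \<omega> :: "'a covec"
  assume w: "\<omega> \<in> {\<omega>. (\<forall>is. length is \<noteq> 2 \<longrightarrow> \<omega> is = 0) \<and> (\<forall>a b. \<omega> [b, a] = - \<omega> [a, b])}"
  have "\<omega> (is[a := is ! b, b := is ! a]) = - \<omega> is" if "a < b" "b < length is" for "is" a b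
  proof (cases "length is = 2")
    case True
    then obtain u v where "is = [u, v]" "a = 0" "b = 1"
      using \<open>a < b\<close> \<open>b < length is\<close> by (auto simp: length_Suc_conv numeral_2_eq_2)
    moreover have "\<omega> [v, u] = - \<omega> [u, v]" using w by blast
    ultimately show ?thesis by simp
  next
    case False
    with w show ?thesis by simp
  qed
  with w show "\<omega> \<in> kforms 2" unfolding kforms_def by blast
qed

lemma kforms_degree: "\<omega> \<in> kforms k \<Longrightarrow> length is \<noteq> k \<Longrightarrow> \<omega> is = 0"
  by (simp add: kforms_def)

lemma kforms_1_eqI:
  fixes \<omega> \<eta> :: "2 covec"
  assumes "\<omega> \<in> kforms 1" "\<eta> \<in> kforms 1" "\<omega> [1] = \<eta> [1]" "\<omega> [2] = \<eta> [2]"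
  shows "\<omega> = \<eta>"
proof
  fix "is" :: "2 list"
  show "\<omega> is = \<eta> is"
  proof (cases "length is = 1")
    case True
    then obtain a where "is = [a]" by (auto simp: length_Suc_conv)
    then show ?thesis using assms exhaust_2[of a] by auto
  next
    case False
    then show ?thesis using assms(1,2) unfolding kforms_1 by simp
  qed
qed

lemma kforms_2_diag: "\<omega> \<in> kforms 2 \<Longrightarrow> \<omega> [a, a] = 0"
  unfolding kforms_2 mem_Collect_eq by (metis neg_equal_zero)

lemma kforms_2_swap: "\<omega> \<in> kforms 2 \<Longrightarrow> \<omega> [b, a] = - \<omega> [a, b]"
  unfolding kforms_2 by blast

text \<open>In two dimensions the other entries of a 2-form are the negative of the 12-component and
  the vanishing diagonal.\<close>

lemma kforms_2_eqI:
  fixes \<omega> \<eta> :: "2 covec"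
  assumes "\<omega> \<in> kforms 2" "\<eta> \<in> kforms 2" "\<omega> [1, 2] = \<eta> [1, 2]"
  shows "\<omega> = \<eta>"
proof
  fix "is" :: "2 list"
  show "\<omega> is = \<eta> is"
  proof (cases "length is = 2")
    case True
    then obtain a b where "is = [a, b]" by (auto simp: length_Suc_conv numeral_2_eq_2)
    then show ?thesis
      using assms exhaust_2[of a] exhaust_2[of b]
      by (auto simp: kforms_2_diag kforms_2_swap[of _ 2 1])
  next
    case False
    then show ?thesis using assms(1,2) unfolding kforms_2 by simp
  qed
qed

lemma kforms_1_eq_iff:
  fixes \<omega> \<eta> :: "2 covec"
  shows "\<omega> \<in> kforms 1 \<Longrightarrow> \<eta> \<in> kforms 1 \<Longrightarrow> \<omega> = \<eta> \<longleftrightarrow> \<omega> [1] = \<eta> [1] \<and> \<omega> [2] = \<eta> [2]"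
  using kforms_1_eqI by blast

lemma kforms_2_eq_iff:
  fixes \<omega> \<eta> :: "2 covec"
  shows "\<omega> \<in> kforms 2 \<Longrightarrow> \<eta> \<in> kforms 2 \<Longrightarrow> \<omega> = \<eta> \<longleftrightarrow> \<omega> [1, 2] = \<eta> [1, 2]"
  using kforms_2_eqI by blast

lemma all_3: "(\<forall>\<mu>::3. P \<mu>) \<longleftrightarrow> P 0 \<and> P 1 \<and> P 2"
proof -
  have "(3::3) = 0" by simp
  then show ?thesis by (simp only: forall_3) blast
qed

section \<open>Inverses of 2 by 2 matrices\<close>

lemma matrix_inv_eqI:
  fixes A B :: "real^'n^'n"
  assumes "A ** B = mat 1"
  shows "matrix_inv A = B"
proof -
  have BA: "B ** A = mat 1" using assms by (simp add: matrix_left_right_inverse)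
  have "\<exists>A'. A ** A' = mat 1 \<and> A' ** A = mat 1" using assms BA by blast
  then have "matrix_inv A ** A = mat 1" unfolding matrix_inv_def by (rule someI2_ex) simp
  then have "matrix_inv A ** (A ** B) = B" by (simp add: matrix_mul_assoc)
  with assms show ?thesis by simp
qed

lemma pos_def_2:
  fixes G :: "real^2^2"
  assumes pd: "\<And>v. v \<noteq> 0 \<Longrightarrow> v \<bullet> (G *v v) > 0" and s: "G $ 2 $ 1 = G $ 1 $ 2"
  shows "det G > 0"
proof -
  have "G $ 1 $ 1 > 0"
    using pd[of "axis 1 1"]
    by (simp add: matrix_vector_mult_def inner_vec_def sum_2 axis_def vec_eq_iff forall_2)
  \<comment> \<open>For v = (-G_12, G_11) one has G v = (0, det G), so the quadratic form takes the
    value G_11 det G.\<close>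
  moreover have "G $ 1 $ 1 * det G > 0"
    using pd[of "vector [- G $ 1 $ 2, G $ 1 $ 1]"] \<open>G $ 1 $ 1 > 0\<close>
    by (simp add: matrix_vector_mult_def inner_vec_def sum_2 vec_eq_iff forall_2 det_2 s algebra_simps)
  ultimately show ?thesis by (simp add: zero_less_mult_iff)
qed
lemma matrix_inv_2:
  fixes G :: "real^2^2"
  assumes "det G \<noteq> 0"
  shows "matrix_inv G =
    vector [vector [G $ 2 $ 2 / det G, - G $ 1 $ 2 / det G],
            vector [- G $ 2 $ 1 / det G, G $ 1 $ 1 / det G]]"
proof (rule matrix_inv_eqI)
  have "det G = G $ 1 $ 1 * G $ 2 $ 2 - G $ 1 $ 2 * G $ 2 $ 1" by (rule det_2)
  with assms show "G ** vector [vector [G $ 2 $ 2 / det G, - G $ 1 $ 2 / det G],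
            vector [- G $ 2 $ 1 / det G, G $ 1 $ 1 / det G]] = mat 1"
    unfolding vec_eq_iff forall_2 matrix_matrix_mult_def mat_def
    by (simp add: sum_2 diff_divide_distrib[symmetric] mult.commute)
qed

text \<open>The entries of G H = H G = 1 appear as scalar equations because the Hodge computations
  are done in components. The last one, det H = 1 / det G, turns \<open>sqrt (det G)\<close> into
  its reciprocal when both indices of a 2-form are raised.\<close>

lemma matrix_inv_2_cancel:
  fixes G :: "real^2^2"
  assumes "det G \<noteq> 0"
  defines "H \<equiv> matrix_inv G"
  shows "G $ 1 $ 1 * H $ 1 $ 1 + G $ 1 $ 2 * H $ 2 $ 1 = 1" "G $ 1 $ 1 * H $ 1 $ 2 + G $ 1 $ 2 * H $ 2 $ 2 = 0"
    "G $ 2 $ 1 * H $ 1 $ 1 + G $ 2 $ 2 * H $ 2 $ 1 = 0" "G $ 2 $ 1 * H $ 1 $ 2 + G $ 2 $ 2 * H $ 2 $ 2 = 1"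
    "H $ 1 $ 1 * G $ 1 $ 1 + H $ 1 $ 2 * G $ 2 $ 1 = 1" "H $ 1 $ 1 * G $ 1 $ 2 + H $ 1 $ 2 * G $ 2 $ 2 = 0"
    "H $ 2 $ 1 * G $ 1 $ 1 + H $ 2 $ 2 * G $ 2 $ 1 = 0" "H $ 2 $ 1 * G $ 1 $ 2 + H $ 2 $ 2 * G $ 2 $ 2 = 1"
    "H $ 1 $ 1 * H $ 2 $ 2 - H $ 1 $ 2 * H $ 2 $ 1 = 1 / det G"
proof -
  have det: "det G = G $ 1 $ 1 * G $ 2 $ 2 - G $ 1 $ 2 * G $ 2 $ 1" by (rule det_2)
  have "G ** H = mat 1 \<and> H ** G = mat 1"
  proof -
    have "invertible G" using assms(1) by (simp add: invertible_det_nz)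
    then show ?thesis unfolding H_def matrix_inv_def invertible_def by (rule someI_ex)
  qed
  then show "G $ 1 $ 1 * H $ 1 $ 1 + G $ 1 $ 2 * H $ 2 $ 1 = 1" "G $ 1 $ 1 * H $ 1 $ 2 + G $ 1 $ 2 * H $ 2 $ 2 = 0"
    "G $ 2 $ 1 * H $ 1 $ 1 + G $ 2 $ 2 * H $ 2 $ 1 = 0" "G $ 2 $ 1 * H $ 1 $ 2 + G $ 2 $ 2 * H $ 2 $ 2 = 1"
    "H $ 1 $ 1 * G $ 1 $ 1 + H $ 1 $ 2 * G $ 2 $ 1 = 1" "H $ 1 $ 1 * G $ 1 $ 2 + H $ 1 $ 2 * G $ 2 $ 2 = 0"
    "H $ 2 $ 1 * G $ 1 $ 1 + H $ 2 $ 2 * G $ 2 $ 1 = 0" "H $ 2 $ 1 * G $ 1 $ 2 + H $ 2 $ 2 * G $ 2 $ 2 = 1"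
    by (simp_all add: vec_eq_iff forall_2 matrix_matrix_mult_def mat_def sum_2)
  show "H $ 1 $ 1 * H $ 2 $ 2 - H $ 1 $ 2 * H $ 2 $ 1 = 1 / det G"
    using assms(1) unfolding H_def
    by (simp add: matrix_inv_2 diff_divide_distrib[symmetric] det[symmetric] mult.commute)
qed

section \<open>The Hodge star of the slices\<close>

lemma hodge_degree:
  fixes \<omega> :: "'n::finite covec"
  assumes "\<And>is. length is \<noteq> k \<Longrightarrow> \<omega> is = 0" "length js + k \<noteq> CARD('n)"
  shows "hodge e G \<omega> js = 0"
proof (cases "CARD('n) - length js = k")
  case True
  \<comment> \<open>Subtraction of naturals is truncated, so this case means that \<open>js\<close>
    is longer than the dimension; then the Levi-Civita factor vanishes on \<open>js\<close>.\<close>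
  then have "k = 0" "length js \<noteq> CARD('n)" using assms(2) by auto
  with True show ?thesis by (simp add: hodge_def levi_civita_length)
next
  case False
  then show ?thesis
    by (simp add: hodge_def Let_def assms(1))
qed

lemma hodge_lat_0: "hodge lat G \<omega> [a, b] = sqrt \<bar>det G\<bar> * \<omega> [] * levi_civita lat [a, b]"
  by (simp add: hodge_def)

lemma hodge_lat_1:
  "hodge lat G \<omega> [1] = - sqrt \<bar>det G\<bar> * (\<omega> [1] * matrix_inv G $ 1 $ 2 + \<omega> [2] * matrix_inv G $ 2 $ 2)"
  "hodge lat G \<omega> [2] = sqrt \<bar>det G\<bar> * (\<omega> [1] * matrix_inv G $ 1 $ 1 + \<omega> [2] * matrix_inv G $ 2 $ 1)"
  by (simp_all only: hodge_def, simp_all add: sum_lists_Suc sum_lists_0 sum_2 levi_civita_2 algebra_simps)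

text \<open>The two orders of the index pair cancel the factor 1/2!, and what remains of the inverse
  metric is its determinant. In particular the star of f vol is f.\<close>

lemma hodge_lat_2:
  assumes "det G > 0" "\<omega> [1, 1] = 0" "\<omega> [2, 2] = 0" "\<omega> [2, 1] = - \<omega> [1, 2]"
  shows "hodge lat G \<omega> [] = \<omega> [1, 2] / sqrt (det G)"
proof -
  let ?H = "matrix_inv G"
  have "hodge lat G \<omega> [] = sqrt (det G) * \<omega> [1, 2] * (?H $ 1 $ 1 * ?H $ 2 $ 2 - ?H $ 1 $ 2 * ?H $ 2 $ 1)"
    unfolding hodge_def using assms
    by (simp add: numeral_2_eq_2 sum_lists_Suc sum_lists_0 sum_2 levi_civita_2) (simp add: field_simps)
  also have "\<dots> = \<omega> [1, 2] * (sqrt (det G) / det G)"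
    using assms(1) by (simp add: matrix_inv_2_cancel)
  also have "sqrt (det G) / det G = 1 / sqrt (det G)"
    using assms(1) by (simp add: field_simps)
  finally show ?thesis by simp
qed

lemma bij_hodge_lat_1:
  assumes "det G > 0"
  shows "bij_betw (hodge lat G) (kforms 1) (kforms 1)"
proof -
  let ?H = "matrix_inv G"
  obtain s where s: "sqrt \<bar>det G\<bar> = s" "s \<noteq> 0" using assms by simp
  \<comment> \<open>By \<open>hodge_lat_1\<close>, the star of \<omega> has the components -s
    \<omega>^2 and s \<omega>^1 in terms of the raised components of \<omega>. Solving gives
    \<omega>^1 = \<eta>_2 / s and \<omega>^2 = -\<eta>_1 / s, and lowering with G gives this
    formula.\<close>
  define inv where "inv \<eta> is = (case is of [m] \<Rightarrow> (G $ 1 $ m * \<eta> [2] - G $ 2 $ m * \<eta> [1]) / s | _ \<Rightarrow> 0)"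
    for \<eta> :: "2 covec" and "is" :: "2 list"
  have hodge: "hodge lat G \<omega> \<in> kforms 1" if "\<omega> \<in> kforms 1" for \<omega>
    using that unfolding kforms_1 by (auto intro!: hodge_degree[of 1])
  have inv: "inv \<eta> \<in> kforms 1" for \<eta>
    unfolding kforms_1 by (auto simp: inv_def split: list.split)
  have cancel: "G $ 1 $ 1 * ?H $ 1 $ 1 + G $ 1 $ 2 * ?H $ 2 $ 1 = 1" "G $ 1 $ 1 * ?H $ 1 $ 2 + G $ 1 $ 2 * ?H $ 2 $ 2 = 0"
    "G $ 2 $ 1 * ?H $ 1 $ 1 + G $ 2 $ 2 * ?H $ 2 $ 1 = 0" "G $ 2 $ 1 * ?H $ 1 $ 2 + G $ 2 $ 2 * ?H $ 2 $ 2 = 1"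
    "?H $ 1 $ 1 * G $ 1 $ 1 + ?H $ 1 $ 2 * G $ 2 $ 1 = 1" "?H $ 1 $ 1 * G $ 1 $ 2 + ?H $ 1 $ 2 * G $ 2 $ 2 = 0"
    "?H $ 2 $ 1 * G $ 1 $ 1 + ?H $ 2 $ 2 * G $ 2 $ 1 = 0" "?H $ 2 $ 1 * G $ 1 $ 2 + ?H $ 2 $ 2 * G $ 2 $ 2 = 1"
    using assms by (simp_all add: matrix_inv_2_cancel)
  show ?thesis
  proof (rule bij_betw_byWitness[where f' = inv])
    have "inv (hodge lat G \<omega>) [m] =
        \<omega> [1] * (?H $ 1 $ 1 * G $ 1 $ m + ?H $ 1 $ 2 * G $ 2 $ m)
        + \<omega> [2] * (?H $ 2 $ 1 * G $ 1 $ m + ?H $ 2 $ 2 * G $ 2 $ m)" for \<omega> m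
      using s(2) by (simp only: inv_def list.case hodge_lat_1 s(1)) (simp add: field_simps)
    then show "\<forall>\<omega>\<in>kforms 1. inv (hodge lat G \<omega>) = \<omega>"
      by (intro ballI kforms_1_eqI inv) (simp_all add: cancel)
    have "hodge lat G (inv \<eta>) [1] =
        \<eta> [1] * (G $ 2 $ 1 * ?H $ 1 $ 2 + G $ 2 $ 2 * ?H $ 2 $ 2)
        - \<eta> [2] * (G $ 1 $ 1 * ?H $ 1 $ 2 + G $ 1 $ 2 * ?H $ 2 $ 2)"
      "hodge lat G (inv \<eta>) [2] =
        \<eta> [2] * (G $ 1 $ 1 * ?H $ 1 $ 1 + G $ 1 $ 2 * ?H $ 2 $ 1)
        - \<eta> [1] * (G $ 2 $ 1 * ?H $ 1 $ 1 + G $ 2 $ 2 * ?H $ 2 $ 1)" for \<eta>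
      using s(2) by (simp_all only: inv_def list.case hodge_lat_1 s(1)) (simp_all add: field_simps)
    then show "\<forall>\<eta>\<in>kforms 1. hodge lat G (inv \<eta>) = \<eta>"
      by (intro ballI kforms_1_eqI inv hodge) (simp_all add: cancel)
  qed (use hodge inv in auto)
qed

text \<open>Needed for Gauss's law, where the codifferential of a 1-form is a scalar recovered from
  a 2-form.\<close>

lemma bij_hodge_lat_0:
  assumes "det G > 0"
  shows "bij_betw (hodge lat G) (kforms 0) (kforms 2)"
proof -
  define inv where "inv \<eta> is = scalar_form (\<eta> [1, 2] / sqrt (det G)) is" for \<eta> :: "2 covec" and "is" :: "2 list"
  have inv: "inv \<eta> \<in> kforms 0" for \<eta>
    by (simp add: kforms_0 inv_def scalar_form_def)
  have hodge: "hodge lat G \<omega> \<in> kforms 2" if "\<omega> \<in> kforms 0" for \<omega>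
  proof -
    have antisym: "levi_civita lat [b, a] = - levi_civita lat [a, b]" for a b :: 2
      using exhaust_2[of a] exhaust_2[of b] by (auto simp: levi_civita_2)
    have "hodge lat G \<omega> is = 0" if "length is \<noteq> 2" for "is"
      using \<open>\<omega> \<in> kforms 0\<close> that unfolding kforms_0 by (intro hodge_degree[of 0]) auto
    moreover have "hodge lat G \<omega> [b, a] = - hodge lat G \<omega> [a, b]" for a b
      unfolding hodge_lat_0 antisym[of a b] by simp
    ultimately show ?thesis
      unfolding kforms_2 by blast
  qed
  show ?thesis
  proof (rule bij_betw_byWitness[where f' = inv])
    show "\<forall>\<omega>\<in>kforms 0. inv (hodge lat G \<omega>) = \<omega>"
      using assms by (auto simp: kforms_0 fun_eq_iff inv_def scalar_form_def hodge_lat_0 levi_civita_2)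
    show "\<forall>\<eta>\<in>kforms 2. hodge lat G (inv \<eta>) = \<eta>"
      using assms by (intro ballI kforms_2_eqI hodge inv)
        (simp_all add: hodge_lat_0 levi_civita_2 inv_def scalar_form_def)
  qed (use hodge inv in auto)
qed

section \<open>The spacetime metric and its Hodge star at a point\<close>

locale lapse_metric =
  fixes G :: "real^3^3" and \<gamma> :: "real^2^2" and N :: real
  assumes N_pos: "N > 0"
    and det_pos: "det \<gamma> > 0"
    and G_00: "G $ 0 $ 0 = - N\<^sup>2"
    and G_0i: "G $ 0 $ lat i = 0" "G $ lat i $ 0 = 0"
    and G_ij: "G $ lat i $ lat j = \<gamma> $ i $ j"
begin

lemmas G_comp = G_00 G_0i[of 1, unfolded lat_def, simplified] G_0i[of 2, unfolded lat_def, simplified]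
  G_ij[of 1 1, unfolded lat_def, simplified] G_ij[of 1 2, unfolded lat_def, simplified]
  G_ij[of 2 1, unfolded lat_def, simplified] G_ij[of 2 2, unfolded lat_def, simplified]

lemma det_G: "det G = - N\<^sup>2 * det \<gamma>"
proof -
  have "(3::3) = 0" by simp
  then show ?thesis by (simp only: det_3 det_2 G_comp) (simp add: algebra_simps)
qed

lemma sqrt_det_G: "sqrt \<bar>det G\<bar> = N * sqrt (det \<gamma>)"
  using N_pos det_pos by (simp add: det_G abs_mult real_sqrt_mult)

text \<open>Vanishing shift makes the metric block diagonal, so it is inverted block by
  block.\<close>

lemma inv_G:
  "matrix_inv G = (\<chi> \<mu> \<nu>. if \<mu> = 0 \<or> \<nu> = 0 then if \<mu> = \<nu> then - 1 / N\<^sup>2 else 0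
      else matrix_inv \<gamma> $ (if \<mu> = 1 then 1 else 2) $ (if \<nu> = 1 then 1 else 2))"
proof (rule matrix_inv_eqI)
  have det: "det \<gamma> = \<gamma> $ 1 $ 1 * \<gamma> $ 2 $ 2 - \<gamma> $ 1 $ 2 * \<gamma> $ 2 $ 1" by (rule det_2)
  show "G ** (\<chi> \<mu> \<nu>. if \<mu> = 0 \<or> \<nu> = 0 then if \<mu> = \<nu> then - 1 / N\<^sup>2 else 0
      else matrix_inv \<gamma> $ (if \<mu> = 1 then 1 else 2) $ (if \<nu> = 1 then 1 else 2)) = mat 1"
    using N_pos det_pos unfolding vec_eq_iff all_3 matrix_matrix_mult_def mat_def
    by (simp add: sum_UNIV_3 G_comp matrix_inv_2 diff_divide_distrib[symmetric] det mult.commute)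
qed

text \<open>The factor g^00 = -1/N^2 cancels the minus sign of -N dt, so n points to the
  future.\<close>

lemma sharp_dt: "sharp G (\<lambda>is. - N * dx 0 is) = axis 0 (1 / N)"
  using N_pos
  by (simp add: sharp_def vec_eq_iff matrix_vector_mult_def sum_UNIV_3 dx_def inv_G axis_def power2_eq_square)

text \<open>In the 0i-components the contracted index is spatial: moving 0 in front of it in
  \<epsilon> gives the minus sign, and \<open>sqrt \<bar>det G\<bar>\<close> supplies N. In the
  12-component it is 0, where g^00 = -1/N^2 leaves -1/N.\<close>

lemma hodge_id_1:
  "hodge id G \<omega> [0, 1] = - N * hodge lat \<gamma> (\<lambda>is. \<omega> (map lat is)) [1]"
  "hodge id G \<omega> [0, 2] = - N * hodge lat \<gamma> (\<lambda>is. \<omega> (map lat is)) [2]"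
  "hodge id G \<omega> [1, 2] = - sqrt (det \<gamma>) * \<omega> [0] / N"
  "hodge id G \<omega> [1, 0] = - hodge id G \<omega> [0, 1]"
  "hodge id G \<omega> [2, 0] = - hodge id G \<omega> [0, 2]"
  "hodge id G \<omega> [2, 1] = - hodge id G \<omega> [1, 2]"
  using N_pos det_pos unfolding hodge_lat_1 hodge_def[of id] sqrt_det_G
  by (simp_all add: sum_lists_Suc sum_lists_0 sum_UNIV_3 levi_civita_3_values levi_civita_not_distinct inv_G)
     (simp_all add: lat_def field_simps power2_eq_square)

lemma hodge_id_1_diag: "hodge id G \<omega> [\<mu>, \<mu>] = 0"
  by (simp add: hodge_def sum_lists_Suc sum_lists_0 levi_civita_not_distinct)

text \<open>In the i-components one of the two contracted indices is 0; its factor -1/N^2 and the N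
  of \<open>sqrt \<bar>det G\<bar>\<close> combine to the -1/N that \<open>E\<close> absorbs. The
  hypotheses fix only the two entries of \<open>E\<close> that the spatial star reads.\<close>

lemma hodge_id_2:
  assumes "\<omega> \<in> kforms 2"
    "E [1] = - \<omega> [0, 1] / N" "E [2] = - \<omega> [0, 2] / N"
  shows "hodge id G \<omega> [0] = N * \<omega> [1, 2] / sqrt (det \<gamma>)"
    "hodge id G \<omega> [1] = hodge lat \<gamma> E [1]"
    "hodge id G \<omega> [2] = hodge lat \<gamma> E [2]"
proof -
  let ?H = "matrix_inv \<gamma>"
  have \<omega>: "\<omega> [\<mu>, \<mu>] = 0" "\<omega> [1, 0] = - \<omega> [0, 1]" "\<omega> [2, 0] = - \<omega> [0, 2]" "\<omega> [2, 1] = - \<omega> [1, 2]" for \<mu>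
    using assms(1) by (rule kforms_2_diag kforms_2_swap)+
  have "hodge id G \<omega> [0] = N * sqrt (det \<gamma>) * \<omega> [1, 2] * (?H $ 1 $ 1 * ?H $ 2 $ 2 - ?H $ 1 $ 2 * ?H $ 2 $ 1)"
    unfolding hodge_def sqrt_det_G using \<omega>
    by (simp add: numeral_2_eq_2 sum_lists_Suc sum_lists_0 sum_UNIV_3 levi_civita_3_values
        levi_civita_not_distinct inv_G) (simp add: field_simps)
  also have "\<dots> = N * \<omega> [1, 2] * (sqrt (det \<gamma>) / det \<gamma>)"
    using det_pos by (simp add: matrix_inv_2_cancel)
  also have "sqrt (det \<gamma>) / det \<gamma> = 1 / sqrt (det \<gamma>)"
    using det_pos by (simp add: field_simps)
  finally show "hodge id G \<omega> [0] = N * \<omega> [1, 2] / sqrt (det \<gamma>)"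
    by (simp only: times_divide_eq_right mult_1_right)
  show "hodge id G \<omega> [1] = hodge lat \<gamma> E [1]" "hodge id G \<omega> [2] = hodge lat \<gamma> E [2]"
    unfolding hodge_def[of id] sqrt_det_G hodge_lat_1 using N_pos det_pos \<omega>
    by (simp_all add: numeral_2_eq_2 sum_lists_Suc sum_lists_0 sum_UNIV_3 levi_civita_3_values
        levi_civita_not_distinct inv_G assms(2,3))
      (simp_all add: field_simps power2_eq_square)
qed

end

text \<open>\<open>inv_into\<close> is meaningful only on the image, hence the membership
  conditions. The point is to trade an equation with the inverse star for one with the star, whose
  components are explicit.\<close>

lemma hodge_inv_eq_iff:
  assumes "bij_betw (hodge e G) (kforms k) T" "\<eta> \<in> T" "\<omega> \<in> kforms k"
  shows "hodge_inv e k G \<eta> = \<omega> \<longleftrightarrow> \<eta> = hodge e G \<omega>"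
  using assms bij_betw_inv_into_left[OF assms(1,3)] bij_betw_inv_into_right[OF assms(1,2)]
  unfolding hodge_inv_def by metis

lemma hodge_inv_in_kforms:
  assumes "bij_betw (hodge e G) (kforms k) T" "\<eta> \<in> T"
  shows "hodge_inv e k G \<eta> \<in> kforms k"
  using assms unfolding hodge_inv_def bij_betw_def by (metis inv_into_into)

section \<open>The exterior derivative in components\<close>

lemma ext_d_degree:
  assumes "open U" "x \<in> U" "\<And>y is. y \<in> U \<Longrightarrow> length is \<noteq> k \<Longrightarrow> \<omega> y is = 0" "length is \<noteq> Suc k"
  shows "ext_d e \<omega> x is = 0"
  unfolding ext_d_def
proof (rule sum.neutral, rule ballI)
  fix a assume "a \<in> {..<length is}"
  then have "length (take a is @ drop (Suc a) is) \<noteq> k"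
    using assms(4) by auto
  \<comment> \<open>The derivative at x sees nearby points, so the vanishing of the shortened
    component is used on all of U.\<close>
  then have "pd (e (is ! a)) (\<lambda>y. \<omega> y (take a is @ drop (Suc a) is)) x = pd (e (is ! a)) (\<lambda>_. 0) x"
    using assms(3) by (intro pd_cong[OF assms(1,2)])
  then show "(-1) ^ a * pd (e (is ! a)) (\<lambda>y. \<omega> y (take a is @ drop (Suc a) is)) x = 0"
    by simp
qed

lemma ext_d_1: "ext_d e \<omega> x [a] = pd (e a) (\<lambda>y. \<omega> y []) x"
  by (simp add: ext_d_def)

lemma ext_d_2: "ext_d e \<omega> x [a, b] = pd (e a) (\<lambda>y. \<omega> y [b]) x - pd (e b) (\<lambda>y. \<omega> y [a]) x"
  by (simp add: ext_d_def)

lemma ext_d_3: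
  "ext_d e \<omega> x [a, b, c] =
     pd (e a) (\<lambda>y. \<omega> y [b, c]) x - pd (e b) (\<lambda>y. \<omega> y [a, c]) x + pd (e c) (\<lambda>y. \<omega> y [a, b]) x"
  by (simp add: ext_d_def numeral_2_eq_2)

lemma ext_d_in_kforms_1:
  assumes "open U" "x \<in> U" "\<And>y. y \<in> U \<Longrightarrow> \<omega> y \<in> kforms 0"
  shows "ext_d e \<omega> x \<in> kforms 1"
  using ext_d_degree[OF assms(1,2), of 0 \<omega>] assms(3) unfolding kforms_0 kforms_1 by auto

lemma ext_d_in_kforms_2:
  assumes "open U" "x \<in> U" "\<And>y. y \<in> U \<Longrightarrow> \<omega> y \<in> kforms 1"
  shows "ext_d e \<omega> x \<in> kforms 2"
  using ext_d_degree[OF assms(1,2), of 1 \<omega>] assms(3) unfolding kforms_1 kforms_2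
  by (auto simp: ext_d_2)

lemma interior_product_axis: "interior_product (axis \<mu> c) \<omega> is = c * \<omega> (\<mu> # is)"
proof -
  have "interior_product (axis \<mu> c) \<omega> is = (\<Sum>\<nu>\<in>UNIV. if \<nu> = \<mu> then c * \<omega> (\<mu> # is) else 0)"
    unfolding interior_product_def by (rule sum.cong) (auto simp: axis_def)
  then show ?thesis by simp
qed

lemma lat_simps: "lat 1 = 1" "lat 2 = 2"
  by (simp_all add: lat_def)

section \<open>The fields in one adapted chart\<close>

locale adapted_chart =
  fixes U :: "(real^3) set" and g F j :: "3 field" and N :: "real^3 \<Rightarrow> real"
  assumes U: "open U"
    and N_pos: "x \<in> U \<Longrightarrow> N x > 0"
    and g_00: "x \<in> U \<Longrightarrow> g x [0, 0] = - (N x)\<^sup>2"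
    and g_0i: "x \<in> U \<Longrightarrow> g x [0, lat i] = 0" "x \<in> U \<Longrightarrow> g x [lat i, 0] = 0"
    and \<gamma>_sym: "x \<in> U \<Longrightarrow> transpose (induced_metric g x) = induced_metric g x"
    and \<gamma>_pos: "x \<in> U \<Longrightarrow> v \<noteq> 0 \<Longrightarrow> v \<bullet> (induced_metric g x *v v) > 0"
    and F_diff: "x \<in> U \<Longrightarrow> (\<lambda>y. F y is) differentiable (at x)"
    and F: "x \<in> U \<Longrightarrow> F x \<in> kforms 2"
    and j: "x \<in> U \<Longrightarrow> j x \<in> kforms 1"
begin

abbreviation "\<gamma> \<equiv> induced_metric g"
abbreviation "E \<equiv> spatial (electric_field g N F)"
abbreviation "B \<equiv> magnetic_field g N F"
abbreviation "\<rho> \<equiv> charge_density g N j"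
abbreviation "J \<equiv> spatial (current g N j)"
abbreviation "vol \<equiv> spatial_volume g"
abbreviation "SF \<equiv> star id (metric_matrix g) F"
abbreviation "SE \<equiv> star lat \<gamma> E"

lemma \<gamma>_det: assumes "x \<in> U" shows "det (\<gamma> x) > 0"
proof (rule pos_def_2)
  have "\<gamma> x $ 2 $ 1 = transpose (\<gamma> x) $ 1 $ 2" by (simp add: transpose_def)
  then show "\<gamma> x $ 2 $ 1 = \<gamma> x $ 1 $ 2" by (simp add: \<gamma>_sym[OF assms])
qed (use \<gamma>_pos[OF assms] in auto)

lemma lapse_metric:
  assumes "x \<in> U" shows "lapse_metric (metric_matrix g x) (\<gamma> x) (N x)"
  using assms by unfold_locales (auto simp: N_pos \<gamma>_det \<gamma>_det[unfolded induced_metric_def] metric_matrix_def induced_metric_def g_00 g_0i)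

lemma unit_normal: "x \<in> U \<Longrightarrow> unit_normal g N x = axis 0 (1 / N x)"
  unfolding unit_normal_def by (rule lapse_metric.sharp_dt[OF lapse_metric])

lemma E_eq: "x \<in> U \<Longrightarrow> E x is = - F x (0 # map lat is) / N x"
  by (simp add: spatial_def electric_field_def unit_normal interior_product_axis)

lemma E: "x \<in> U \<Longrightarrow> E x \<in> kforms 1"
  unfolding kforms_1 by (simp add: E_eq kforms_degree[OF F])

lemma SF:
  assumes "x \<in> U"
  shows "SF x [0] = N x * F x [1, 2] / sqrt (det (\<gamma> x))" "SF x [1] = SE x [1]" "SF x [2] = SE x [2]"
    "length is \<noteq> 1 \<Longrightarrow> SF x is = 0"
proof -
  interpret lapse_metric "metric_matrix g x" "\<gamma> x" "N x" using assms by (rule lapse_metric)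
  note E1 = E_eq[OF assms, of "[1]"] and E2 = E_eq[OF assms, of "[2]"]
  show "SF x [0] = N x * F x [1, 2] / sqrt (det (\<gamma> x))" "SF x [1] = SE x [1]" "SF x [2] = SE x [2]"
    unfolding star_def using hodge_id_2[OF F[OF assms], of "E x"] E1 E2
    by (simp_all add: lat_simps)
  show "SF x is = 0" if "length is \<noteq> 1"
    using that unfolding star_def by (intro hodge_degree[of 2] kforms_degree[OF F[OF assms]]) auto
qed

lemma SF_1: "x \<in> U \<Longrightarrow> SF x \<in> kforms 1"
  unfolding kforms_1 by (simp add: SF)

lemma SE: "x \<in> U \<Longrightarrow> SE x \<in> kforms 1"
  using bij_betwE[OF bij_hodge_lat_1[OF \<gamma>_det]] E unfolding star_def by blast

lemma B_eq: "x \<in> U \<Longrightarrow> B x = F x [1, 2] / sqrt (det (\<gamma> x))"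
  using N_pos[of x] by (simp add: magnetic_field_def unit_normal interior_product_axis SF)

text \<open>The \<open>sqrt (det \<gamma>)\<close> of the volume form cancels the one in
  \<open>B\<close>, so the time derivative in Faraday's law acts on F_12 alone.\<close>

lemma B_vol: "x \<in> U \<Longrightarrow> fn_mult B vol x is = F x [1, 2] * levi_civita lat is"
  using \<gamma>_det[of x] by (simp add: fn_mult_def volume_form_def B_eq)

lemma \<rho>_eq: "x \<in> U \<Longrightarrow> \<rho> x = - j x [0] / N x"
  by (simp add: charge_density_def unit_normal interior_product_axis)

lemma J_eq:
  assumes "x \<in> U"
  shows "J x is = N x * j x (map lat is)"
proof -
  \<comment> \<open>With vanishing shift the 1-form dual to n is a multiple of dt; its restriction
    to the slices is zero, and \<open>\<rho>\<close> drops out of \<open>J\<close>.\<close>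
  have "flat (metric_matrix g x) (axis 0 (1 / N x)) (map lat is) = 0"
    using g_0i[OF assms]
    by (auto simp: flat_def matrix_vector_mult_def metric_matrix_def axis_def if_distrib cong: if_cong split: list.split)
  then show ?thesis
    by (simp add: spatial_def current_def unit_normal[OF assms])
qed

lemma J: "x \<in> U \<Longrightarrow> J x \<in> kforms 1"
  using j[of x] unfolding kforms_1 by (simp add: J_eq)

section \<open>The homogeneous equation and Faraday's law\<close>

lemma pd_F_swap:
  assumes "x \<in> U"
  shows "pd \<mu> (\<lambda>y. F y [b, a]) x = - pd \<mu> (\<lambda>y. F y [a, b]) x"
proof -
  have "pd \<mu> (\<lambda>y. F y [b, a]) x = pd \<mu> (\<lambda>y. - F y [a, b]) x"
    by (intro pd_cong[OF U assms] kforms_2_swap F)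
  also have "\<dots> = - pd \<mu> (\<lambda>y. F y [a, b]) x"
    by (intro pd_uminus F_diff assms)
  finally show ?thesis .
qed

lemma pd_F_diag:
  assumes "x \<in> U"
  shows "pd \<mu> (\<lambda>y. F y [a, a]) x = 0"
  using pd_F_swap[OF assms, of \<mu> a a] by simp

text \<open>The common quantity to which \<open>homogeneous_iff\<close> and
  \<open>Faraday_iff\<close> both reduce.\<close>

definition "dF x = pd 0 (\<lambda>y. F y [1, 2]) x - pd 1 (\<lambda>y. F y [0, 2]) x + pd 2 (\<lambda>y. F y [0, 1]) x"

lemma homogeneous_iff:
  assumes x: "x \<in> U"
  shows "(\<forall>is. ext_d id F x is = 0) \<longleftrightarrow> dF x = 0"
proof
  assume "\<forall>is. ext_d id F x is = 0"
  from this[rule_format, of "[0, 1, 2]"] show "dF x = 0" by (simp add: ext_d_3 dF_def)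
next
  assume "dF x = 0"
  \<comment> \<open>With a repeated index the terms cancel or vanish by the antisymmetry of F; a
    permutation of 0, 1, 2 only changes the sign.\<close>
  then have "\<forall>a b c. ext_d id F x [a, b, c] = 0"
    by (simp add: all_3 ext_d_3 dF_def pd_F_diag[OF x]
        pd_F_swap[OF x, of _ 1 0] pd_F_swap[OF x, of _ 2 0] pd_F_swap[OF x, of _ 2 1])
  then have "ext_d id F x is = 0" if "length is = 3" for "is"
    using that by (auto simp: length_Suc_conv numeral_3_eq_3)
  moreover have "ext_d id F x is = 0" if "length is \<noteq> 3" for "is"
    using that by (intro ext_d_degree[OF U x, of 2] kforms_degree[OF F]) auto
  ultimately show "\<forall>is. ext_d id F x is = 0"
    by blast
qed

lemma Faraday_iff:
  assumes x: "x \<in> U"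
  shows "(\<forall>is. ext_d lat (fn_mult N E) x is = - time_deriv (fn_mult B vol) x is) \<longleftrightarrow> dF x = 0"
proof -
  \<comment> \<open>The lapse cancels, so only derivatives of F remain.\<close>
  have NE: "fn_mult N E y is = - F y (0 # map lat is)" if "y \<in> U" for y "is"
    using N_pos[OF that] that by (simp add: fn_mult_def E_eq)
  have pd_NE: "pd \<mu> (\<lambda>y. fn_mult N E y is) x = - pd \<mu> (\<lambda>y. F y (0 # map lat is)) x" for \<mu> "is"
    using pd_cong[OF U x NE] by (simp add: pd_uminus F_diff x)
  have dt: "time_deriv (fn_mult B vol) x is = pd 0 (\<lambda>y. F y [1, 2] * levi_civita lat is) x" for "is"
    unfolding time_deriv_def by (rule pd_cong[OF U x B_vol])
  have NE_1: "fn_mult N E y \<in> kforms 1" if "y \<in> U" for y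
    unfolding kforms_1 by (simp add: NE that kforms_degree[OF F])
  have d: "ext_d lat (fn_mult N E) x \<in> kforms 2"
    by (rule ext_d_in_kforms_2[OF U x NE_1])
  have t: "(\<lambda>is. - time_deriv (fn_mult B vol) x is) \<in> kforms 2"
  proof -
    have "- time_deriv (fn_mult B vol) x [b, a] = - (- time_deriv (fn_mult B vol) x [a, b])" for a b
      using exhaust_2[of a] exhaust_2[of b]
      by (auto simp: dt levi_civita_2 pd_uminus F_diff x)
    moreover have "- time_deriv (fn_mult B vol) x is = 0" if "length is \<noteq> 2" for "is"
      using that by (simp add: dt levi_civita_length)
    ultimately show ?thesis unfolding kforms_2 mem_Collect_eq by blast
  qed
  have "(\<forall>is. ext_d lat (fn_mult N E) x is = - time_deriv (fn_mult B vol) x is) \<longleftrightarrow>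
      ext_d lat (fn_mult N E) x [1, 2] = - time_deriv (fn_mult B vol) x [1, 2]"
    using kforms_2_eq_iff[OF d t] by (simp only: fun_eq_iff)
  also have "\<dots> \<longleftrightarrow> dF x = 0"
    by (auto simp: ext_d_2 pd_NE dt dF_def lat_simps levi_civita_2)
  finally show ?thesis .
qed

section \<open>The inhomogeneous equation: Gauss's and Ampere's laws\<close>

lemma Gauss_iff:
  assumes x: "x \<in> U"
  shows "(\<forall>is. - codiff lat 1 \<gamma> E x is = scalar_form (\<rho> x / \<epsilon>) is) \<longleftrightarrow>
    ext_d id SF x [1, 2] = inverse \<epsilon> * (sqrt (det (\<gamma> x)) * \<rho> x)"
proof -
  let ?\<eta> = "ext_d lat SE x" and ?r = "scalar_form (\<rho> x / \<epsilon>) :: 2 covec"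
  have \<eta>: "?\<eta> \<in> kforms 2"
    by (rule ext_d_in_kforms_2[OF U x SE])
  have r: "?r \<in> kforms 0"
    by (simp add: kforms_0 scalar_form_def)
  note bij = bij_hodge_lat_0[OF \<gamma>_det[OF x]]
  \<comment> \<open>The factor (-1)^1 in the codifferential cancels the minus sign in front of
    it.\<close>
  have "(\<forall>is. - codiff lat 1 \<gamma> E x is = ?r is) \<longleftrightarrow> hodge_inv lat 0 (\<gamma> x) ?\<eta> = ?r"
    by (auto simp: codiff_def star_inv_def)
  also have "\<dots> \<longleftrightarrow> ?\<eta> = hodge lat (\<gamma> x) ?r"
    by (rule hodge_inv_eq_iff[OF bij \<eta> r])
  also have "\<dots> \<longleftrightarrow> ?\<eta> [1, 2] = hodge lat (\<gamma> x) ?r [1, 2]"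
    by (rule kforms_2_eq_iff[OF \<eta> bij_betwE[OF bij, rule_format, OF r]])
  \<comment> \<open>The 12-component of d involves only the spatial components of star F, which are
    those of the spatial star of E.\<close>
  also have "?\<eta> [1, 2] = ext_d id SF x [1, 2]"
    using pd_cong[OF U x, of "\<lambda>y. SF y [1]"] pd_cong[OF U x, of "\<lambda>y. SF y [2]"]
    by (simp add: ext_d_2 SF lat_simps)
  also have "hodge lat (\<gamma> x) ?r [1, 2] = inverse \<epsilon> * (sqrt (det (\<gamma> x)) * \<rho> x)"
    using \<gamma>_det[OF x] by (simp add: divide_inverse hodge_lat_0 levi_civita_2 scalar_form_def)
  finally show ?thesis .
qed

lemma Ampere_iff:
  assumes x: "x \<in> U"
  shows "(\<forall>is. codiff lat 2 \<gamma> (fn_mult (\<lambda>y. N y * B y) vol) x is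
        = c * J x is + star_inv lat 1 \<gamma> (time_deriv SE) x is) \<longleftrightarrow>
    ext_d id SF x [0, 1] = - c * hodge lat (\<gamma> x) (J x) [1] \<and>
    ext_d id SF x [0, 2] = - c * hodge lat (\<gamma> x) (J x) [2]"
proof -
  let ?NB = "star lat \<gamma> (fn_mult (\<lambda>y. N y * B y) vol)"
  let ?\<alpha> = "ext_d lat ?NB x" and ?\<tau> = "time_deriv SE x"
  let ?\<beta> = "\<lambda>is. c * J x is + hodge_inv lat 1 (\<gamma> x) ?\<tau> is"
  note bij = bij_hodge_lat_1[OF \<gamma>_det[OF x]]
  have vol: "fn_mult (\<lambda>y. N y * B y) vol y is = N y * F y [1, 2] * levi_civita lat is" if "y \<in> U" for y "is"
    using B_vol[OF that, of "is"] by (simp add: fn_mult_def mult.assoc)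
  \<comment> \<open>The spatial star of vol is 1, which leaves the function N B, the dt-component of
    star F.\<close>
  have NB: "?NB y [] = SF y [0]" if "y \<in> U" for y
    using \<gamma>_det[OF that] that by (simp add: star_def[of lat] hodge_lat_2 vol SF(1) levi_civita_2)
  have NB_0: "?NB y \<in> kforms 0" if "y \<in> U" for y
    unfolding kforms_0 star_def
    using that by (auto intro!: hodge_degree[of 2] simp: vol levi_civita_length)
  have \<alpha>: "?\<alpha> \<in> kforms 1"
    by (rule ext_d_in_kforms_1[OF U x NB_0])
  have \<tau>: "?\<tau> \<in> kforms 1"
  proof -
    have "?\<tau> is = 0" if "length is \<noteq> 1" for "is"
      using pd_cong[OF U x, of "\<lambda>y. SE y is" "\<lambda>_. 0"] SE that unfolding time_deriv_def kforms_1 by simp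
    then show ?thesis unfolding kforms_1 by blast
  qed
  have \<beta>: "?\<beta> \<in> kforms 1"
    using J[OF x] hodge_inv_in_kforms[OF bij \<tau>] unfolding kforms_1 by simp
  have hodge_\<tau>: "hodge lat (\<gamma> x) (hodge_inv lat 1 (\<gamma> x) ?\<tau>) = ?\<tau>"
    using hodge_inv_eq_iff[OF bij \<tau> hodge_inv_in_kforms[OF bij \<tau>]] by simp
  have hodge_\<beta>: "hodge lat (\<gamma> x) ?\<beta> [i] = c * hodge lat (\<gamma> x) (J x) [i] + ?\<tau> [i]" for i
  proof -
    have "hodge lat (\<gamma> x) ?\<beta> [i] = c * hodge lat (\<gamma> x) (J x) [i]
        + hodge lat (\<gamma> x) (hodge_inv lat 1 (\<gamma> x) ?\<tau>) [i]"
      using exhaust_2[of i] by (auto simp only: hodge_lat_1) (simp_all add: algebra_simps)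
    then show ?thesis by (simp only: hodge_\<tau>)
  qed
  \<comment> \<open>The 0i-component of d star F is the time derivative of the i-component of star
    F, which gives \<open>?\<tau>\<close>, minus the i-th derivative of its 0-component, which gives
    \<open>?\<alpha>\<close>.\<close>
  have \<alpha>_\<tau>: "?\<alpha> [i] - ?\<tau> [i] = - ext_d id SF x [0, lat i]" for i
  proof -
    have "SF y [lat i] = SE y [i]" if "y \<in> U" for y
      using exhaust_2[of i] SF[OF that] by (auto simp: lat_simps)
    then show ?thesis
      using pd_cong[OF U x NB, where \<mu> = "lat i"] pd_cong[OF U x, of "\<lambda>y. SF y [lat i]" "\<lambda>y. SE y [i]" 0]
      by (simp add: ext_d_1 ext_d_2 time_deriv_def)
  qed
  have "(\<forall>is. codiff lat 2 \<gamma> (fn_mult (\<lambda>y. N y * B y) vol) x is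
        = c * J x is + star_inv lat 1 \<gamma> (time_deriv SE) x is) \<longleftrightarrow> hodge_inv lat 1 (\<gamma> x) ?\<alpha> = ?\<beta>"
    by (auto simp: codiff_def star_inv_def fun_eq_iff)
  also have "\<dots> \<longleftrightarrow> ?\<alpha> = hodge lat (\<gamma> x) ?\<beta>"
    by (rule hodge_inv_eq_iff[OF bij \<alpha> \<beta>])
  also have "\<dots> \<longleftrightarrow> ?\<alpha> [1] = hodge lat (\<gamma> x) ?\<beta> [1] \<and> ?\<alpha> [2] = hodge lat (\<gamma> x) ?\<beta> [2]"
    by (rule kforms_1_eq_iff[OF \<alpha> bij_betwE[OF bij, rule_format, OF \<beta>]])
  also have "\<dots> \<longleftrightarrow> ext_d id SF x [0, 1] = - c * hodge lat (\<gamma> x) (J x) [1] \<and>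
    ext_d id SF x [0, 2] = - c * hodge lat (\<gamma> x) (J x) [2]"
  proof -
    have "a = c * h + b \<longleftrightarrow> d = - c * h" if "a - b = - d" for a b d h
      using that by auto
    from this[OF \<alpha>_\<tau>[of 1]] this[OF \<alpha>_\<tau>[of 2]] show ?thesis
      unfolding hodge_\<beta> lat_simps by (rule conj_cong)
  qed
  finally show ?thesis .
qed

text \<open>A spacetime 2-form is determined by its components 12, 01 and 02. In the star of j the
  first carries the charge density and the others the current: the N in the definition of
  \<open>J\<close> is exactly the lapse factor of the spacetime star.\<close>

lemma inhomogeneous_iff:
  assumes x: "x \<in> U"
  shows "(\<forall>is. ext_d id SF x is = c * star id (metric_matrix g) j x is) \<longleftrightarrow>
    ext_d id SF x [1, 2] = c * (sqrt (det (\<gamma> x)) * \<rho> x) \<and>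
    ext_d id SF x [0, 1] = - c * hodge lat (\<gamma> x) (J x) [1] \<and>
    ext_d id SF x [0, 2] = - c * hodge lat (\<gamma> x) (J x) [2]"
    (is "?L \<longleftrightarrow> ?R")
proof -
  interpret lapse_metric "metric_matrix g x" "\<gamma> x" "N x" using x by (rule lapse_metric)
  let ?S = "star id (metric_matrix g) j x"
  have J: "hodge lat (\<gamma> x) (J x) [i] = N x * hodge lat (\<gamma> x) (\<lambda>is. j x (map lat is)) [i]" for i
    using exhaust_2[of i] by (auto simp only: hodge_lat_1 J_eq[OF x]) (simp_all add: algebra_simps)
  have S: "?S [1, 2] = sqrt (det (\<gamma> x)) * \<rho> x" "?S [0, 1] = - hodge lat (\<gamma> x) (J x) [1]"
    "?S [0, 2] = - hodge lat (\<gamma> x) (J x) [2]"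
    by (simp_all add: star_def hodge_id_1 J \<rho>_eq[OF x])
  have swap: "?S [1, 0] = - ?S [0, 1]" "?S [2, 0] = - ?S [0, 2]" "?S [2, 1] = - ?S [1, 2]" "?S [\<mu>, \<mu>] = 0" for \<mu>
    unfolding star_def by (rule hodge_id_1 hodge_id_1_diag)+
  have d: "ext_d id SF x \<in> kforms 2"
    by (rule ext_d_in_kforms_2[OF U x SF_1])
  have zero: "ext_d id SF x is = c * ?S is" if "length is \<noteq> 2" for "is"
  proof -
    have "?S is = 0"
      using that unfolding star_def by (intro hodge_degree[of 1] kforms_degree[OF j[OF x]]) auto
    then show ?thesis using kforms_degree[OF d that] by simp
  qed
  show ?thesis
  proof
    assume ?L then show ?R by (simp add: S)
  next
    assume R: ?R
    have "\<forall>a b. ext_d id SF x [a, b] = c * ?S [a, b]"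
      using R unfolding all_3 swap kforms_2_diag[OF d]
        kforms_2_swap[OF d, of 1 0] kforms_2_swap[OF d, of 2 0] kforms_2_swap[OF d, of 2 1] S
      by simp
    then have "ext_d id SF x is = c * ?S is" if "length is = 2" for "is"
      using that by (auto simp: length_Suc_conv numeral_2_eq_2)
    with zero show ?L by blast
  qed
qed

lemma Maxwell_iff:
  assumes x: "x \<in> U"
  shows "(\<forall>is. ext_d id F x is = 0 \<and> ext_d id SF x is = inverse \<epsilon> * star id (metric_matrix g) j x is) \<longleftrightarrow>
    (\<forall>is. ext_d lat (fn_mult N E) x is = - time_deriv (fn_mult B vol) x is \<and>
      - codiff lat 1 \<gamma> E x is = scalar_form (\<rho> x / \<epsilon>) is \<and>
      codiff lat 2 \<gamma> (fn_mult (\<lambda>y. N y * B y) vol) x is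
        = inverse \<epsilon> * J x is + star_inv lat 1 \<gamma> (time_deriv SE) x is)"
  \<comment> \<open>The rewriting turns both sides into the same conjunction, in the order Faraday,
    Gauss, Ampere.\<close>
  unfolding all_conj_distrib homogeneous_iff[OF x] inhomogeneous_iff[OF x] Faraday_iff[OF x]
    Gauss_iff[OF x] Ampere_iff[OF x]
  by (rule refl)

end

section \<open>From single charts to the spacetime\<close>

lemma smooth_on_differentiable: "smooth_on U f \<Longrightarrow> x \<in> U \<Longrightarrow> f differentiable (at x)"
  unfolding smooth_on_def by (drule spec[of _ "[]"]) simp

lemma in_chart_pos:
  assumes "\<forall>p\<in>S. f p > (0::real)" "fst c \<subseteq> S" "x \<in> coords c"
  shows "in_chart c f x > 0"
  using assms(1,2) inv_into_into[OF assms(3)[unfolded coords_def]] unfolding in_chart_def by blast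

lemma adapted_chartI:
  assumes "foliated_spacetime X A t N g" "form_field A 2 F" "form_field A 1 j" "c \<in> A"
  shows "adapted_chart (coords c) (g c) (F c) (j c) (in_chart c N)"
proof
  have m: "smooth_manifold3 X A" and N: "\<forall>p\<in>topspace X. N p > 0"
    using assms(1) unfolding foliated_spacetime_def by blast+
  show "open (coords c)"
    using m assms(4) unfolding smooth_manifold3_def by blast
  have "fst c \<subseteq> topspace X"
    using m assms(4) unfolding smooth_manifold3_def by blast
  then show "in_chart c N x > 0" if "x \<in> coords c" for x
    using in_chart_pos[OF N] that by blast
  fix x assume x: "x \<in> coords c"
  show "g c x [0, 0] = - (in_chart c N x)\<^sup>2" "g c x [0, lat i] = 0" "g c x [lat i, 0] = 0"
    "transpose (induced_metric (g c) x) = induced_metric (g c) x"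
    "v \<noteq> 0 \<Longrightarrow> v \<bullet> (induced_metric (g c) x *v v) > 0" for i v
    using assms(1,4) x unfolding foliated_spacetime_def by blast+
  show "(\<lambda>y. F c y is) differentiable (at x)" for "is"
    using assms(2,4) x unfolding form_field_def tensor_field_def
    by (blast intro: smooth_on_differentiable)
  show "F c x \<in> kforms 2" "j c x \<in> kforms 1"
    using assms(2,3,4) x unfolding form_field_def by blast+
qed

theorem mainTheorem9:
  fixes X :: "'a topology" and A :: "'a chart set"
    and t N :: "'a \<Rightarrow> real" and g F j :: "'a tensor" and \<epsilon>\<^sub>0 :: real
  assumes "foliated_spacetime X A t N g"
    and "\<epsilon>\<^sub>0 > 0"
    and "form_field A 2 F"
    and "form_field A 1 j"
  shows
    "(\<forall>c\<in>A. \<forall>x\<in>coords c. \<forall>is.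
        ext_d id (F c) x is = 0 \<and>
        ext_d id (star id (metric_matrix (g c)) (F c)) x is
          = inverse \<epsilon>\<^sub>0 * star id (metric_matrix (g c)) (j c) x is)
     \<longleftrightarrow>
     (\<forall>c\<in>A. \<forall>x\<in>coords c. \<forall>is.
        let lapse = in_chart c N; \<gamma> = induced_metric (g c); vol = spatial_volume (g c);
            E = spatial (electric_field (g c) lapse (F c));
            B = magnetic_field (g c) lapse (F c);
            \<rho> = charge_density (g c) lapse (j c);
            J = spatial (current (g c) lapse (j c))
        in
          ext_d lat (fn_mult lapse E) x is = - time_deriv (fn_mult B vol) x is \<and>
          - codiff lat 1 \<gamma> E x is = scalar_form (\<rho> x / \<epsilon>\<^sub>0) is \<and>
          codiff lat 2 \<gamma> (fn_mult (\<lambda>y. lapse y * B y) vol) x is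
            = inverse \<epsilon>\<^sub>0 * J x is + star_inv lat 1 \<gamma> (time_deriv (star lat \<gamma> E)) x is)"
  unfolding Let_def
\<comment> \<open>Both formulations quantify over the same charts and points, so it suffices to
  compare them in each chart at each point.\<close>
proof (intro ball_cong refl)
  fix c x assume c: "c \<in> A" and x: "x \<in> coords c"
  interpret adapted_chart "coords c" "g c" "F c" "j c" "in_chart c N"
    by (rule adapted_chartI[OF assms(1,3,4) c])
  show "(\<forall>is. ext_d id (F c) x is = 0 \<and>
        ext_d id (star id (metric_matrix (g c)) (F c)) x is
          = inverse \<epsilon>\<^sub>0 * star id (metric_matrix (g c)) (j c) x is) \<longleftrightarrow>
     (\<forall>is. ext_d lat (fn_mult (in_chart c N) E) x is = - time_deriv (fn_mult B vol) x is \<and>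
          - codiff lat 1 \<gamma> E x is = scalar_form (\<rho> x / \<epsilon>\<^sub>0) is \<and>
          codiff lat 2 \<gamma> (fn_mult (\<lambda>y. in_chart c N y * B y) vol) x is
            = inverse \<epsilon>\<^sub>0 * J x is + star_inv lat 1 \<gamma> (time_deriv SE) x is)"
    by (rule Maxwell_iff[OF x])
qed

end
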